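(* Let $H$ be a numerical semigroup and let $H^*=M-M$ be the dual of its maximal ideal $M=H\setminus\{0\}$. (a) If $H$ is almost symmetric, then $H^*$ is almost symmetric if and only if $\mathrm{m}(H)=\mathrm{t}(H)+\mathrm{t}(H^* )$. (b) If $H^*$ is almost symmetric, then $H$ is almost symmetric if and only if $\mathrm{m}(H)=\mathrm{t}(H)+\mathrm{t}(H^* )$.
   Context: A numerical semigroup is a subset $H\subseteq\mathbb{N}=\{0,1,2,\dots\}$ containing $0$, closed under addition, with $\mathbb{N}\setminus H$ finite. The multiplicity $\mathrm{m}(H)$ is the least nonzero element of $H$, the genus is $\mathrm{g}(H)=|\mathbb{N}\setminus H|$, and the Frobenius number $\mathrm{F}(H)$ is the largest integer in $\mathbb{N}\setminus H$. The set of pseudo-Frobenius numbers is $\mathrm{PF}(H)=\{x\in\mathbb{Z}\setminus H \mid x+h\in H\text{ for all }h\in H,\ h\neq 0\}$, and the type is $\mathrm{t}(H)=|\mathrm{PF}(H)|$. $H$ is almost symmetric if $2\mathrm{g}(H)=\mathrm{F}(H)+\mathrm{t}(H)$. With $M=H\setminus\{0\}$, $H^*=M-M=\{z\in\mathbb{Z}\mid z+M\subseteq M\}$, which is a numerical semigroup.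
   Formalization: H is assumed different from ℕ, where F(H) is undefined and, with the convention F(ℕ) = −1, the claim fails (m(ℕ) = 1 but t(ℕ) + t(ℕ* ) = 2); this convention is used when H* = ℕ. *)

theory Defs
  imports Main
begin

text \<open>
  Numerical semigroups are encoded as sets of integers contained in \<open>{0..}\<close>, because
  pseudo-Frobenius numbers and the elements of \<open>M - M\<close> are a priori integers.
\<close>

definition numerical_semigroup :: "int set \<Rightarrow> bool" where
  "numerical_semigroup H \<longleftrightarrow>
     H \<subseteq> {0..} \<and> 0 \<in> H \<and> (\<forall>x\<in>H. \<forall>y\<in>H. x + y \<in> H) \<and> finite ({0..} - H)"

definition ns_multiplicity :: "int set \<Rightarrow> int" where
  "ns_multiplicity H = (LEAST x. x \<in> H \<and> x \<noteq> 0)"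

definition ns_genus :: "int set \<Rightarrow> nat" where
  "ns_genus H = card ({0..} - H)"

text \<open>
  The set of gaps of \<open>{0..}\<close> is empty, so its maximum does not exist; the value there is the
  usual convention \<open>-1\<close>, the largest integer outside \<open>{0..}\<close>. It is needed since the dual of
  \<open>{0} \<union> {m..}\<close> is \<open>{0..}\<close>.
\<close>

definition ns_frobenius :: "int set \<Rightarrow> int" where
  "ns_frobenius H = (if H = {0..} then -1 else Max ({0..} - H))"

definition pseudo_frobenius :: "int set \<Rightarrow> int set" where
  "pseudo_frobenius H = {x. x \<notin> H \<and> (\<forall>h\<in>H. h \<noteq> 0 \<longrightarrow> x + h \<in> H)}"

definition ns_type :: "int set \<Rightarrow> nat" where
  "ns_type H = card (pseudo_frobenius H)"

definition almost_symmetric :: "int set \<Rightarrow> bool" where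
  "almost_symmetric H \<longleftrightarrow> 2 * int (ns_genus H) = ns_frobenius H + int (ns_type H)"

definition maximal_ideal :: "int set \<Rightarrow> int set" where
  "maximal_ideal H = H - {0}"

definition ns_dual :: "int set \<Rightarrow> int set" where
  "ns_dual H = {z. \<forall>x\<in>maximal_ideal H. z + x \<in> maximal_ideal H}"

end

theory Submission
  imports Defs
begin

text \<open>
  Call \<open>2 g(H) - F(H) - t(H)\<close> the defect of \<open>H\<close>, so that almost symmetric means defect zero.
  Since \<open>H\<^sup>*\<close> is the disjoint union of \<open>H\<close> and \<open>PF(H)\<close>, and \<open>F(H\<^sup>*) = F(H) - m(H)\<close>, the defect
  of \<open>H\<^sup>*\<close> is the defect of \<open>H\<close> plus \<open>m(H) - t(H) - t(H\<^sup>*)\<close>. If one of the two defects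
  vanishes, then the other one does if and only if \<open>m(H) = t(H) + t(H\<^sup>*)\<close>.
\<close>

lemma ns_multiplicity_least:
  assumes "numerical_semigroup H"
  shows "ns_multiplicity H \<in> H" and "ns_multiplicity H > 0"
    and "\<And>x. x \<in> H \<Longrightarrow> x \<noteq> 0 \<Longrightarrow> ns_multiplicity H \<le> x"
proof -
  have fin: "finite ({0..} - H)" and sub: "H \<subseteq> {0..}"
    using assms by (auto simp: numerical_semigroup_def)
  have "\<not> {0<..} \<subseteq> {0..} - H"
    using fin infinite_Ioi[of "0::int"] finite_subset by blast
  then obtain y where "y \<in> H" "y > 0" by auto
  then have ex: "\<exists>n. int n \<in> H \<and> n \<noteq> 0"
    by (intro exI[of _ "nat y"]) auto
  \<comment> \<open>\<open>LEAST\<close> on integers has no well-order behind it, so the minimum is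
    found among the naturals and carried back.\<close>
  define k where "k = (LEAST n. int n \<in> H \<and> n \<noteq> 0)"
  have k: "int k \<in> H" "k \<noteq> 0"
    using LeastI_ex[OF ex] by (simp_all add: k_def)
  have least: "int k \<le> x" if "x \<in> H" "x \<noteq> 0" for x
  proof -
    have "x \<ge> 0" using that sub by auto
    then have "k \<le> nat x"
      unfolding k_def using that by (intro Least_le) auto
    then show ?thesis using \<open>x \<ge> 0\<close> by linarith
  qed
  have "ns_multiplicity H = int k"
    unfolding ns_multiplicity_def using k least by (intro Least_equality) auto
  with k least show "ns_multiplicity H \<in> H" "ns_multiplicity H > 0"
    "\<And>x. x \<in> H \<Longrightarrow> x \<noteq> 0 \<Longrightarrow> ns_multiplicity H \<le> x" by simp_all
qed

text \<open>Admitting \<open>f = -1\<close> lets one criterion cover the default value as well,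
  since a dual may be all of \<open>{0..}\<close>.\<close>

lemma ns_frobenius_eqI:
  assumes "H \<subseteq> {0..}" and "f \<notin> H" and "f \<ge> -1" and "\<And>z. z > f \<Longrightarrow> z \<in> H"
  shows "ns_frobenius H = f"
proof (cases "f = -1")
  case True
  then have "H = {0..}" using assms by force
  then show ?thesis using True by (simp add: ns_frobenius_def)
next
  case False
  have "{0..} - H \<subseteq> {0..f}" using assms(4) by force
  then have "finite ({0..} - H)" by (rule finite_subset) simp
  moreover have "x \<le> f" if "x \<in> {0..} - H" for x
    using that assms(4)[of x] by force
  ultimately have "Max ({0..} - H) = f"
    using assms False by (intro Max_eqI) auto
  moreover have "H \<noteq> {0..}" using assms(2,3) False by force
  ultimately show ?thesis by (simp add: ns_frobenius_def)
qed

lemma ns_frobenius_greatest: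
  assumes "numerical_semigroup H" and "H \<noteq> {0..}"
  shows "ns_frobenius H \<ge> 0" and "ns_frobenius H \<notin> H"
    and "\<And>z. z > ns_frobenius H \<Longrightarrow> z \<in> H"
proof -
  have fin: "finite ({0..} - H)" and ne: "{0..} - H \<noteq> {}"
    using assms by (auto simp: numerical_semigroup_def)
  have F: "ns_frobenius H = Max ({0..} - H)"
    using assms(2) by (simp add: ns_frobenius_def)
  show ge: "ns_frobenius H \<ge> 0" and "ns_frobenius H \<notin> H"
    using Max_in[OF fin ne] F by auto
  show "z \<in> H" if "z > ns_frobenius H" for z
    using Max_ge[OF fin, of z] that ge F by force
qed

text \<open>
  The hypothesis \<open>H \<noteq> {0..}\<close> matters: otherwise \<open>-1\<close> is pseudo-Frobenius.
\<close>

lemma pseudo_frobenius_nonneg: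
  assumes H: "numerical_semigroup H" "H \<noteq> {0..}" and z: "z \<in> pseudo_frobenius H"
  shows "z \<ge> 0"
proof (rule ccontr)
  assume "\<not> z \<ge> 0"
  note m = ns_multiplicity_least[OF H(1)]
  note F = ns_frobenius_greatest[OF H]
  have shift: "z + h \<in> H" if "h \<in> H" "h \<noteq> 0" for h
    using z that by (simp add: pseudo_frobenius_def)
  \<comment> \<open>For negative \<open>z\<close> this element of \<open>H\<close> is below the
    multiplicity m, so it is 0 and \<open>z\<close> is -m. Shifting F + m, which lies in
    \<open>H\<close>, by -m then puts F into \<open>H\<close>.\<close>
  have "z + ns_multiplicity H \<in> H" using shift m(1,2) by force
  then have "z = - ns_multiplicity H"
    using m(3)[of "z + ns_multiplicity H"] \<open>\<not> z \<ge> 0\<close> by force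
  moreover have "ns_frobenius H + ns_multiplicity H \<in> H"
    using F(3) m(2) by simp
  ultimately have "ns_frobenius H \<in> H"
    using shift[of "ns_frobenius H + ns_multiplicity H"] F(1) m(2) by simp
  then show False using F(2) by simp
qed

lemma ns_dual_eq:
  assumes "numerical_semigroup H" and "H \<noteq> {0..}"
  shows "ns_dual H = H \<union> pseudo_frobenius H"
proof
  show "ns_dual H \<subseteq> H \<union> pseudo_frobenius H"
    by (auto simp: ns_dual_def maximal_ideal_def pseudo_frobenius_def)
next
  have H: "x \<ge> 0" "x + y \<in> H" if "x \<in> H" "y \<in> H" for x y
    using assms(1) that by (auto simp: numerical_semigroup_def)
  show "H \<union> pseudo_frobenius H \<subseteq> ns_dual H"
  proof
    fix z assume z: "z \<in> H \<union> pseudo_frobenius H"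
    \<comment> \<open>The dual also demands \<open>z + x \<noteq> 0\<close>, which nonnegativity of
      \<open>z\<close> secures.\<close>
    have "z \<ge> 0" using z H pseudo_frobenius_nonneg[OF assms] by auto
    moreover have "z + x \<in> H" if "x \<in> H" "x \<noteq> 0" for x
      using z that H by (auto simp: pseudo_frobenius_def)
    ultimately show "z \<in> ns_dual H"
      using H by (force simp: ns_dual_def maximal_ideal_def)
  qed
qed

text \<open>Passing to the dual fills exactly the gaps that are pseudo-Frobenius.\<close>

lemma ns_genus_dual:
  assumes "numerical_semigroup H" and "H \<noteq> {0..}"
  shows "int (ns_genus (ns_dual H)) = int (ns_genus H) - int (ns_type H)"
proof -
  have fin: "finite ({0..} - H)"
    using assms(1) by (simp add: numerical_semigroup_def)
  have sub: "pseudo_frobenius H \<subseteq> {0..} - H"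
    using pseudo_frobenius_nonneg[OF assms] by (auto simp: pseudo_frobenius_def)
  have "{0..} - ns_dual H = ({0..} - H) - pseudo_frobenius H"
    by (auto simp: ns_dual_eq[OF assms])
  then show ?thesis
    using card_Diff_subset[OF finite_subset[OF sub fin] sub] card_mono[OF fin sub]
    by (simp add: ns_genus_def ns_type_def)
qed

text \<open>Adding m to F - m gives F, a gap; anything larger than F - m exceeds F after adding any
  nonzero element of \<open>H\<close>, as such an element is at least m.\<close>

lemma ns_frobenius_dual:
  assumes "numerical_semigroup H" and "H \<noteq> {0..}"
  shows "ns_frobenius (ns_dual H) = ns_frobenius H - ns_multiplicity H"
proof (rule ns_frobenius_eqI)
  note m = ns_multiplicity_least[OF assms(1)]
  note F = ns_frobenius_greatest[OF assms]
  show "ns_dual H \<subseteq> {0..}"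
    using assms(1) pseudo_frobenius_nonneg[OF assms]
    by (auto simp: ns_dual_eq[OF assms] numerical_semigroup_def)
  show "ns_frobenius H - ns_multiplicity H \<notin> ns_dual H"
    using m(1,2) F(2) by (force simp: ns_dual_def maximal_ideal_def)
  \<comment> \<open>F + 1 is a nonzero element of \<open>H\<close>, so m \<le> F + 1. Equality means
    that the dual is \<open>{0..}\<close>.\<close>
  show "ns_frobenius H - ns_multiplicity H \<ge> -1"
    using m(3)[of "ns_frobenius H + 1"] F(1) F(3)[of "ns_frobenius H + 1"] by simp
  show "z \<in> ns_dual H" if z: "z > ns_frobenius H - ns_multiplicity H" for z
  proof -
    have "z + x > ns_frobenius H" if "x \<in> H" "x \<noteq> 0" for x
      using m(3)[OF that] z by linarith
    then show ?thesis
      using F(1,3) by (force simp: ns_dual_def maximal_ideal_def)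
  qed
qed

text \<open>The case \<open>H = {0..}\<close> is a genuine exception: it is its own dual and almost
  symmetric, with -1 as its only pseudo-Frobenius number, but m = 1 while the types add up to
  2.\<close>

theorem theorem3p7:
  fixes H :: "int set"
  assumes "numerical_semigroup H" and "H \<noteq> {0..}"
  shows "(almost_symmetric H \<longrightarrow>
           (almost_symmetric (ns_dual H) \<longleftrightarrow>
             ns_multiplicity H = int (ns_type H) + int (ns_type (ns_dual H)))) \<and>
         (almost_symmetric (ns_dual H) \<longrightarrow>
           (almost_symmetric H \<longleftrightarrow>
             ns_multiplicity H = int (ns_type H) + int (ns_type (ns_dual H))))"
  unfolding almost_symmetric_def ns_genus_dual[OF assms] ns_frobenius_dual[OF assms]
  by auto

end
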